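(* Let $f:2^U\to\mathbb{R}_{\ge0}$ be monotone submodular, $U$ partitioned into $U_1,\dots,U_N$, $k_1,\dots,k_N$ positive integers with $k_j\le|U_j|$ and $\min_ik_i\ge4$, $\mathcal{P}=\{S\subseteq U:|S\cap U_j|\le k_j\ \forall j\}$, $\phi=\lfloor\sqrt{\min_{i\in[N]}k_i}\rfloor-1$, $r_j=\lfloor k_j/\phi\rfloor$. Let $S$ be the output of Block-Greedy with subroutine Greedy-Subroutine-Mono, and let $A$ be the output of the algorithm Greedy run with input $S$ (both described in the context). Then $f(A)\ge\max\{1/2,\ 1-1/e-\frac{1}{\phi+1}\}f(OPT)$, where $OPT\in\arg\max_{S\in\mathcal{P}}f(S)$.
   Context: $f$ submodular: $f(A\cup\{x\})-f(A)\ge f(B\cup\{x\})-f(B)$ for $A\subseteq B\subseteq U$, $x\notin B$; monotone: $f(X)\le f(Y)$ for $X\subseteq Y$; $\Delta f(S,x)=f(S\cup\{x\})-f(S)$. Block-Greedy with Greedy-Subroutine-Mono: $S\gets\emptyset$; for $i=1,\dots,\phi$: for $j=1,\dots,N$: repeat $r_j$ times: $S\gets S\cup\{\arg\max_{x\in U_j}\Delta f(S,x)\}$; return $S$. Algorithm Greedy with input $S$: $A\gets S$; while there exists $x\in U\setminus A$ with $A\cup\{x\}\in\mathcal{P}$: $A\gets A\cup\{\arg\max_{x\in U\setminus A,\ A\cup\{x\}\in\mathcal{P}}\Delta f(A,x)\}$; return $A$. *)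

theory Defs
  imports Complex_Main "HOL-Library.Disjoint_Sets"
begin

definition marginal :: "('a set \<Rightarrow> real) \<Rightarrow> 'a set \<Rightarrow> 'a \<Rightarrow> real" where
  "marginal f S x = f (S \<union> {x}) - f S"

definition submodular_on :: "'a set \<Rightarrow> ('a set \<Rightarrow> real) \<Rightarrow> bool" where
  "submodular_on U f \<longleftrightarrow>
     (\<forall>A B. \<forall>x\<in>U. A \<subseteq> B \<and> B \<subseteq> U \<and> x \<notin> B \<longrightarrow>
        f (A \<union> {x}) - f A \<ge> f (B \<union> {x}) - f B)"

definition partition_feasible :: "'a set \<Rightarrow> (nat \<Rightarrow> 'a set) \<Rightarrow> (nat \<Rightarrow> nat) \<Rightarrow> nat \<Rightarrow> 'a set set" where
  "partition_feasible U Us k N = {S. S \<subseteq> U \<and> (\<forall>j\<in>{1..N}. card (S \<inter> Us j) \<le> k j)}"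

text \<open>
  The algorithms are rendered as input/output relations on the current solution, because the
  maximiser chosen in each step need not be unique: a pair is in the relation iff some choice of
  the maximisers leads from the first component to the second.
\<close>

text \<open>The maximum ranges over all of \<open>V\<close>, so an element already in \<open>S\<close> may be chosen; it then
  has marginal value \<open>0\<close> and the solution does not change.\<close>

definition pick_max :: "('a set \<Rightarrow> real) \<Rightarrow> 'a set \<Rightarrow> 'a set rel" where
  "pick_max f V = {(S, S \<union> {x}) | S x. is_arg_max (marginal f S) (\<lambda>y. y \<in> V) x}"

definition greedy_subroutine_mono :: "('a set \<Rightarrow> real) \<Rightarrow> 'a set \<Rightarrow> nat \<Rightarrow> 'a set rel" where
  "greedy_subroutine_mono f V m = pick_max f V ^^ m"

text \<open>Sequential execution of \<open>R 1\<close>, \<open>R 2\<close>, ..., \<open>R n\<close>, in this order.\<close>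

primrec for_loop :: "(nat \<Rightarrow> 'b rel) \<Rightarrow> nat \<Rightarrow> 'b rel" where
  "for_loop R 0 = Id"
| "for_loop R (Suc n) = for_loop R n O R (Suc n)"

definition block_greedy_mono ::
  "('a set \<Rightarrow> real) \<Rightarrow> (nat \<Rightarrow> 'a set) \<Rightarrow> nat \<Rightarrow> (nat \<Rightarrow> nat) \<Rightarrow> nat \<Rightarrow> 'a set set" where
  "block_greedy_mono f Us N r m =
     {S. ({}, S) \<in> for_loop (\<lambda>i. for_loop (\<lambda>j. greedy_subroutine_mono f (Us j) (r j)) N) m}"

definition greedy_step :: "('a set \<Rightarrow> real) \<Rightarrow> 'a set \<Rightarrow> 'a set set \<Rightarrow> 'a set rel" where
  "greedy_step f U P =
     {(A, A \<union> {x}) | A x. is_arg_max (marginal f A) (\<lambda>y. y \<in> U - A \<and> A \<union> {y} \<in> P) x}"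

definition greedy :: "('a set \<Rightarrow> real) \<Rightarrow> 'a set \<Rightarrow> 'a set set \<Rightarrow> 'a set \<Rightarrow> 'a set set" where
  "greedy f U P S =
     {A. (S, A) \<in> (greedy_step f U P)\<^sup>* \<and> \<not> (\<exists>x\<in>U - A. A \<union> {x} \<in> P)}"

end

theory Submission
  imports Defs
begin

text \<open>
  Each of the \<open>\<phi>\<close> rounds of Block-Greedy closes at least the fraction \<open>c / (1 + c)\<close> of the gap to
  \<open>f OPT\<close>, as soon as \<open>c * k j \<le> r j\<close> for all blocks, because every one of the \<open>r j\<close> picks in
  \<open>Us j\<close> gains at least the marginal value, with respect to the \<^emph>\<open>end\<close> of the round, of any element of
  \<open>OPT \<inter> Us j\<close>. Since \<open>(\<phi> + 1)\<^sup>2 \<le> k j\<close>, one may take \<open>c = 1 / (\<phi> + 1)\<close>.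
  For the factor \<open>1 / 2\<close>, both algorithms only ever add an element that is a best one of its own block,
  and the final \<open>A\<close> fills every block; so the gains of the elements of \<open>A\<close> can be matched,
  block by block, with the marginal values of the elements of \<open>OPT\<close>.
\<close>

section \<open>Marginal values of a monotone submodular function on a partitioned ground set\<close>

locale partitioned_submodular =
  fixes f :: "'a set \<Rightarrow> real" and U :: "'a set" and Us :: "nat \<Rightarrow> 'a set" and N :: nat
  assumes finite_U: "finite U"
    and mono_f: "mono_on (Pow U) f"
    and submodular_f: "submodular_on U f"
    and Union_Us: "(\<Union>j\<in>{1..N}. Us j) = U"
    and disjoint_Us: "disjoint_family_on Us {1..N}"
begin

lemma Us_subset: "j \<in> {1..N} \<Longrightarrow> Us j \<subseteq> U"
  using Union_Us by blast

lemma f_mono: "S \<subseteq> T \<Longrightarrow> T \<subseteq> U \<Longrightarrow> f S \<le> f T"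
  using mono_f by (auto simp: mono_on_def)

lemma marginal_nonneg: "S \<subseteq> U \<Longrightarrow> x \<in> U \<Longrightarrow> 0 \<le> marginal f S x"
  unfolding marginal_def using f_mono[of S "S \<union> {x}"] by auto

lemma marginal_mem: "x \<in> S \<Longrightarrow> marginal f S x = 0"
  by (simp add: marginal_def insert_absorb)

text \<open>\<open>submodular_on\<close> is silent about \<open>x\<close> in \<open>T\<close>; there
  the left side is 0 and monotonicity makes the right side nonnegative. This case matters because
  block maxima may fall on elements already chosen.\<close>

lemma marginal_antimono:
  assumes "S \<subseteq> T" "T \<subseteq> U" "x \<in> U"
  shows "marginal f T x \<le> marginal f S x"
proof (cases "x \<in> T")
  case True
  then show ?thesis using assms marginal_mem[of x T] marginal_nonneg[of S x] by auto
next
  case False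
  then show ?thesis using assms submodular_f unfolding submodular_on_def marginal_def by blast
qed

lemma union_le_sum_marginal:
  assumes "S \<subseteq> U" "T \<subseteq> U"
  shows "f (S \<union> T) - f S \<le> (\<Sum>x\<in>T. marginal f S x)"
proof -
  have "finite T" using assms finite_U finite_subset by blast
  then show ?thesis using assms(2)
  proof induction
    case empty
    then show ?case by simp
  next
    case (insert x T)
    have "f (S \<union> insert x T) - f (S \<union> T) = marginal f (S \<union> T) x"
      by (simp add: marginal_def)
    also have "\<dots> \<le> marginal f S x"
      using insert.prems assms(1) by (intro marginal_antimono) auto
    finally show ?case using insert by simp
  qed
qed

lemma sum_partition:
  assumes "T \<subseteq> U"
  shows "(\<Sum>x\<in>T. g x) = (\<Sum>j\<in>{1..N}. \<Sum>x\<in>T \<inter> Us j. g x)"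
proof -
  have "T = (\<Union>j\<in>{1..N}. T \<inter> Us j)" using assms Union_Us by blast
  moreover have "sum g (\<Union>j\<in>{1..N}. T \<inter> Us j) = (\<Sum>j\<in>{1..N}. sum g (T \<inter> Us j))"
  proof (rule sum.UNION_disjoint)
    show "\<forall>j\<in>{1..N}. finite (T \<inter> Us j)" using assms finite_U finite_subset by blast
    show "\<forall>i\<in>{1..N}. \<forall>j\<in>{1..N}. i \<noteq> j \<longrightarrow> T \<inter> Us i \<inter> (T \<inter> Us j) = {}"
      using disjoint_Us unfolding disjoint_family_on_def by blast
  qed simp
  ultimately show ?thesis by simp
qed

section \<open>The gap to an arbitrary set after complete rounds of Block-Greedy\<close>

lemma pick_maxE:
  assumes "(S, T) \<in> pick_max f V"
  obtains x where "x \<in> V" "T = insert x S" "f T - f S = marginal f S x"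
    "\<And>y. y \<in> V \<Longrightarrow> marginal f S y \<le> marginal f S x"
  using assms unfolding pick_max_def is_arg_max_def marginal_def
  by (auto simp: not_less)

text \<open>Each pick gains the largest current marginal value over \<open>V\<close>, and
  submodularity lets this be compared with marginals at the final set \<open>T\<close>, so all
  \<open>m\<close> picks obey one and the same lower bound. The size bound is only an inequality
  because a pick may repeat an old element.\<close>

lemma picks_gain:
  assumes "(S, T) \<in> pick_max f V ^^ m" "S \<subseteq> U" "V \<subseteq> U"
  shows "S \<subseteq> T \<and> T \<subseteq> S \<union> V \<and> card (T - S) \<le> m \<and> (\<forall>y\<in>V. real m * marginal f T y \<le> f T - f S)"
  using assms(1)
proof (induction m arbitrary: T)
  case 0
  then show ?case by simp
next
  case (Suc m)
  then obtain R where R: "(S, R) \<in> pick_max f V ^^ m" "(R, T) \<in> pick_max f V" by auto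
  note IH = Suc.IH[OF R(1)]
  obtain x where x: "x \<in> V" "T = insert x R" "f T - f R = marginal f R x"
      "\<And>y. y \<in> V \<Longrightarrow> marginal f R y \<le> marginal f R x"
    using R(2) by (rule pick_maxE) blast
  have TU: "T \<subseteq> U" using IH x assms(2,3) by blast
  have "real (Suc m) * marginal f T y \<le> f T - f S" if y: "y \<in> V" for y
  proof -
    have *: "marginal f T y \<le> marginal f R y"
      using TU x(2) y assms(3) by (intro marginal_antimono) auto
    have "real m * marginal f T y \<le> real m * marginal f R y"
      using * by (intro mult_left_mono) auto
    also have "\<dots> \<le> f R - f S" using IH y by blast
    finally show ?thesis using * x(3) x(4)[OF y] by (simp add: algebra_simps)
  qed
  moreover have "card (T - S) \<le> Suc m"
  proof -
    have "card (T - S) \<le> card (insert x (R - S))"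
      using TU x(2) finite_U by (intro card_mono) (auto intro: finite_subset)
    also have "\<dots> \<le> Suc (card (R - S))" by (rule card_insert_le_m1) auto
    finally show ?thesis using IH by simp
  qed
  ultimately show ?case using IH x by blast
qed

text \<open>Averaging: every \<open>x\<close> in \<open>X\<close> has marginal value at most the
  mean gain \<open>(f T - f S) / m\<close>, and \<open>c\<close> times the number of these elements
  is at most \<open>m\<close>.\<close>

lemma picks_gain_sum:
  assumes "(S, T) \<in> pick_max f V ^^ m" "S \<subseteq> U" "V \<subseteq> U" "X \<subseteq> V"
    and "0 < c" "c * real (card X) \<le> real m"
  shows "c * (\<Sum>x\<in>X. marginal f T x) \<le> f T - f S"
proof -
  note gain = picks_gain[OF assms(1-3)]
  have ST: "f S \<le> f T" using gain assms(2,3) by (intro f_mono) blast+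
  show ?thesis
  proof (cases "X = {}")
    case True
    then show ?thesis using ST by simp
  next
    case False
    \<comment> \<open>A nonempty \<open>X\<close> forces \<open>m\<close> to be positive, which
      makes the mean gain meaningful.\<close>
    have "finite X" by (rule finite_subset[OF order.trans[OF assms(4,3)] finite_U])
    then have "0 < real (card X)" using False by (simp add: card_gt_0_iff)
    then have "0 < c * real (card X)" by (rule mult_pos_pos[OF assms(5)])
    then have m: "0 < real m" using assms(6) by (rule less_le_trans)
    have "(\<Sum>x\<in>X. marginal f T x) \<le> (\<Sum>x\<in>X. (f T - f S) / real m)"
    proof (rule sum_mono)
      fix x assume "x \<in> X"
      then have "real m * marginal f T x \<le> f T - f S" using gain assms(4) by blast
      then show "marginal f T x \<le> (f T - f S) / real m"
        using m by (simp only: pos_le_divide_eq mult.commute)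
    qed
    then have "c * (\<Sum>x\<in>X. marginal f T x) \<le> c * (\<Sum>x\<in>X. (f T - f S) / real m)"
      using assms(5) by (intro mult_left_mono) simp_all
    also have "\<dots> = (c * real (card X)) * ((f T - f S) / real m)" by simp
    also have "\<dots> \<le> real m * ((f T - f S) / real m)"
      using assms(6) ST by (intro mult_right_mono) simp_all
    also have "\<dots> = f T - f S" using m by simp
    finally show ?thesis .
  qed
qed

text \<open>Induction over the blocks visited so far in one round. The sizes are tracked for every
  block, visited or not, so that the output of Block-Greedy can later be shown feasible.\<close>

lemma round_gain:
  assumes "(S, T) \<in> for_loop (\<lambda>j. greedy_subroutine_mono f (Us j) (r j)) n"
    and "n \<le> N" "S \<subseteq> U" "X \<subseteq> U" "0 < c"
    and "\<And>j. j \<in> {1..N} \<Longrightarrow> c * real (card (X \<inter> Us j)) \<le> real (r j)"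
  shows "S \<subseteq> T \<and> T \<subseteq> U \<and>
    (\<forall>i\<in>{1..N}. card (T \<inter> Us i) \<le> card (S \<inter> Us i) + (if i \<le> n then r i else 0)) \<and>
    c * (\<Sum>j\<in>{1..n}. \<Sum>x\<in>X \<inter> Us j. marginal f T x) \<le> f T - f S"
  using assms(1,2)
proof (induction n arbitrary: T)
  case 0
  then show ?case using assms(3) by simp
next
  case (Suc n)
  then obtain R where R: "(S, R) \<in> for_loop (\<lambda>j. greedy_subroutine_mono f (Us j) (r j)) n"
    "(R, T) \<in> pick_max f (Us (Suc n)) ^^ r (Suc n)" by (auto simp: greedy_subroutine_mono_def)
  have n: "Suc n \<in> {1..N}" using Suc.prems by simp
  have IH: "S \<subseteq> R" "R \<subseteq> U"
      "\<And>i. i \<in> {1..N} \<Longrightarrow> card (R \<inter> Us i) \<le> card (S \<inter> Us i) + (if i \<le> n then r i else 0)"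
      "c * (\<Sum>j\<in>{1..n}. \<Sum>x\<in>X \<inter> Us j. marginal f R x) \<le> f R - f S"
    using Suc.IH[OF R(1)] Suc.prems by auto
  have T: "R \<subseteq> T" "T \<subseteq> R \<union> Us (Suc n)" "card (T - R) \<le> r (Suc n)"
    using picks_gain[OF R(2) IH(2) Us_subset[OF n]] by auto
  have TU: "T \<subseteq> U" using T IH(2) Us_subset[OF n] by blast
  have "card (T \<inter> Us i) \<le> card (S \<inter> Us i) + (if i \<le> Suc n then r i else 0)"
    if i: "i \<in> {1..N}" for i
  proof (cases "i = Suc n")
    case True
    have "card (T \<inter> Us i) \<le> card ((R \<inter> Us i) \<union> (T - R))"
      using TU finite_U by (intro card_mono) (auto intro: finite_subset[of _ U] dest: subsetD[OF IH(2)])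
    also have "\<dots> \<le> card (R \<inter> Us i) + card (T - R)" by (rule card_Un_le)
    finally show ?thesis using True T(3) IH(3)[OF i] by simp
  next
    case False
    then have "Us i \<inter> Us (Suc n) = {}"
      using disjoint_Us i n unfolding disjoint_family_on_def by blast
    then have "T \<inter> Us i = R \<inter> Us i" using T by blast
    then show ?thesis using IH(3)[OF i] False by (auto split: if_splits)
  qed
  moreover have "c * (\<Sum>j\<in>{1..Suc n}. \<Sum>x\<in>X \<inter> Us j. marginal f T x) \<le> f T - f S"
  proof -
    \<comment> \<open>Passing from \<open>R\<close> to \<open>T\<close> only lowers marginals, so
      the bound for the earlier blocks survives with all marginals taken at the new
      endpoint.\<close>
    have "(\<Sum>j\<in>{1..n}. \<Sum>x\<in>X \<inter> Us j. marginal f T x) \<le> (\<Sum>j\<in>{1..n}. \<Sum>x\<in>X \<inter> Us j. marginal f R x)"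
      using T(1) TU assms(4) by (intro sum_mono marginal_antimono) auto
    then have "c * (\<Sum>j\<in>{1..n}. \<Sum>x\<in>X \<inter> Us j. marginal f T x) \<le> f R - f S"
      using IH(4) assms(5) by (meson mult_left_mono order.trans less_imp_le)
    moreover have "c * (\<Sum>x\<in>X \<inter> Us (Suc n). marginal f T x) \<le> f T - f R"
      using assms(6)[OF n] by (intro picks_gain_sum[OF R(2) IH(2) Us_subset[OF n] _ assms(5)]) auto
    ultimately show ?thesis by (simp add: distrib_left)
  qed
  ultimately show ?case using T(1) IH(1) TU by blast
qed

text \<open>A round from \<open>R\<close> to \<open>T\<close> gains at least \<open>c\<close> times
  the gap left at its end \<open>T\<close>, hence the gap at \<open>R\<close> is at least
  \<open>1 + c\<close> times the gap at \<open>T\<close>. The product form iterates without any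
  assumption on the sign of the gap.\<close>

lemma rounds_gap:
  assumes "(S, T) \<in> for_loop (\<lambda>i. for_loop (\<lambda>j. greedy_subroutine_mono f (Us j) (r j)) N) m"
    and "S \<subseteq> U" "X \<subseteq> U" "0 < c"
    and "\<And>j. j \<in> {1..N} \<Longrightarrow> c * real (card (X \<inter> Us j)) \<le> real (r j)"
  shows "S \<subseteq> T \<and> T \<subseteq> U \<and> (\<forall>j\<in>{1..N}. card (T \<inter> Us j) \<le> card (S \<inter> Us j) + m * r j) \<and>
    (1 + c) ^ m * (f X - f T) \<le> f X - f S"
  using assms(1)
proof (induction m arbitrary: T)
  case 0
  then show ?case using assms(2) by simp
next
  case (Suc m)
  then obtain R where R:
    "(S, R) \<in> for_loop (\<lambda>i. for_loop (\<lambda>j. greedy_subroutine_mono f (Us j) (r j)) N) m"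
    "(R, T) \<in> for_loop (\<lambda>j. greedy_subroutine_mono f (Us j) (r j)) N" by auto
  note IH = Suc.IH[OF R(1)]
  have T: "R \<subseteq> T" "T \<subseteq> U"
      "\<And>j. j \<in> {1..N} \<Longrightarrow> card (T \<inter> Us j) \<le> card (R \<inter> Us j) + r j"
      "c * (\<Sum>j\<in>{1..N}. \<Sum>x\<in>X \<inter> Us j. marginal f T x) \<le> f T - f R"
    using round_gain[OF R(2) order.refl _ assms(3-5)] IH by auto
  have "f X - f T \<le> f (T \<union> X) - f T" using f_mono[of X "T \<union> X"] T(2) assms(3) by auto
  also have "\<dots> \<le> (\<Sum>x\<in>X. marginal f T x)" by (rule union_le_sum_marginal[OF T(2) assms(3)])
  also have "\<dots> = (\<Sum>j\<in>{1..N}. \<Sum>x\<in>X \<inter> Us j. marginal f T x)" by (rule sum_partition[OF assms(3)])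
  finally have "c * (f X - f T) \<le> f T - f R"
    using T(4) assms(4) by (meson mult_left_mono order.trans less_imp_le)
  then have "(1 + c) * (f X - f T) \<le> f X - f R" by (simp add: algebra_simps)
  then have "(1 + c) ^ m * ((1 + c) * (f X - f T)) \<le> (1 + c) ^ m * (f X - f R)"
    using assms(4) by (intro mult_left_mono) auto
  also have "\<dots> \<le> f X - f S" using IH by blast
  finally have "(1 + c) ^ Suc m * (f X - f T) \<le> f X - f S" by (simp add: mult_ac)
  moreover have "card (T \<inter> Us j) \<le> card (S \<inter> Us j) + Suc m * r j" if "j \<in> {1..N}" for j
    using T(3)[OF that] IH that by fastforce
  ultimately show ?case using IH T by blast
qed

section \<open>Best-of-block picks and the factor 1/2\<close>

text \<open>Feasibility depends only on the block counts, so the chosen \<open>x\<close> may be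
  exchanged for any other new element \<open>y\<close> of its block. Thus \<open>y\<close> competed
  with \<open>x\<close> in the greedy maximum; elements of the block already in \<open>A\<close>
  have marginal value 0 and cannot beat \<open>x\<close>.\<close>

lemma greedy_step_pick_max:
  assumes "(A, B) \<in> greedy_step f U P" "P = partition_feasible U Us k N" "A \<subseteq> U"
  shows "B \<in> P \<and> (\<exists>j\<in>{1..N}. (A, B) \<in> pick_max f (Us j))"
proof -
  obtain x where x: "B = A \<union> {x}" "x \<in> U" "x \<notin> A" "A \<union> {x} \<in> P"
      "\<And>y. y \<in> U - A \<Longrightarrow> A \<union> {y} \<in> P \<Longrightarrow> marginal f A y \<le> marginal f A x"
    using assms(1) unfolding greedy_step_def is_arg_max_def by (auto simp: not_less)
  obtain j where j: "j \<in> {1..N}" "x \<in> Us j" using x(2) Union_Us by blast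
  have "marginal f A y \<le> marginal f A x" if y: "y \<in> Us j" for y
  proof (cases "y \<in> A")
    case True
    then show ?thesis using marginal_mem marginal_nonneg assms(3) x(2) by auto
  next
    case False
    have fin: "finite A" using assms(3) finite_U finite_subset by blast
    have "card ((A \<union> {y}) \<inter> Us i) \<le> card ((A \<union> {x}) \<inter> Us i)" if i: "i \<in> {1..N}" for i
    proof (cases "i = j")
      case True
      then show ?thesis using False x(3) y j(2) fin by (simp add: Int_insert_left)
    next
      case False
      then have "Us i \<inter> Us j = {}" using disjoint_Us i j unfolding disjoint_family_on_def by blast
      then have "(A \<union> {y}) \<inter> Us i \<subseteq> (A \<union> {x}) \<inter> Us i" using y by blast
      then show ?thesis using fin by (intro card_mono) auto
    qed
    moreover have "card ((A \<union> {x}) \<inter> Us i) \<le> k i" if "i \<in> {1..N}" for i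
      using x(4) that by (auto simp: assms(2) partition_feasible_def)
    moreover have "A \<union> {y} \<subseteq> U" using assms(3) y Us_subset[OF j(1)] by blast
    ultimately have "A \<union> {y} \<in> P"
      unfolding assms(2) partition_feasible_def by (blast intro: order.trans)
    then show ?thesis using x(5) False y Us_subset[OF j(1)] by blast
  qed
  then have "(A, B) \<in> pick_max f (Us j)"
    using x(1) j(2) unfolding pick_max_def is_arg_max_def by (auto simp: not_less)
  then show ?thesis using j(1) x by blast
qed

text \<open>\<open>w a\<close> is the gain of \<open>a\<close> at the moment when \<open>a\<close> entered \<open>A\<close>.\<close>

lemma gains_dominate_marginals:
  assumes "(S, A) \<in> (\<Union>j\<in>{1..N}. pick_max f (Us j))\<^sup>*" "S = {}"
  shows "A \<subseteq> U \<and> (\<exists>w. f A = f {} + (\<Sum>a\<in>A. w a) \<and>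
    (\<forall>j\<in>{1..N}. \<forall>a\<in>A \<inter> Us j. \<forall>y\<in>Us j. marginal f A y \<le> w a))"
  using assms
proof (induction rule: rtrancl_induct)
  case base
  then show ?case by simp
next
  case (step A B)
  then obtain w where w: "A \<subseteq> U" "f A = f {} + (\<Sum>a\<in>A. w a)"
    "\<And>j a y. j \<in> {1..N} \<Longrightarrow> a \<in> A \<Longrightarrow> a \<in> Us j \<Longrightarrow> y \<in> Us j \<Longrightarrow> marginal f A y \<le> w a" by blast
  obtain i where i: "i \<in> {1..N}" "(A, B) \<in> pick_max f (Us i)" using step by blast
  then obtain x where x: "x \<in> Us i" "B = insert x A" "f B - f A = marginal f A x"
      "\<And>y. y \<in> Us i \<Longrightarrow> marginal f A y \<le> marginal f A x"
    by (blast elim: pick_maxE)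
  show ?case
  proof (cases "x \<in> A")
    case True
    then have "B = A" using x(2) by blast
    then show ?thesis using step by blast
  next
    case False
    let ?w = "w(x := marginal f A x)"
    have BU: "B \<subseteq> U" using x w(1) Us_subset[OF i(1)] by blast
    have "finite A" using w(1) finite_U finite_subset by blast
    then have "(\<Sum>a\<in>B. ?w a) = marginal f A x + (\<Sum>a\<in>A. ?w a)"
      using x(2) False by simp
    also have "(\<Sum>a\<in>A. ?w a) = (\<Sum>a\<in>A. w a)" using False by (intro sum.cong) auto
    finally have "f B = f {} + (\<Sum>a\<in>B. ?w a)" using w(2) x(3) by simp
    moreover have "marginal f B y \<le> ?w a"
      if j: "j \<in> {1..N}" and a: "a \<in> B \<inter> Us j" and y: "y \<in> Us j" for j a y
    proof -
      \<comment> \<open>Marginals only shrink, so the gains recorded earlier keep dominating. For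
        the new element \<open>x\<close>, disjointness identifies \<open>Us j\<close> with the block
        over which \<open>x\<close> was maximal.\<close>
      have "marginal f B y \<le> marginal f A y"
        using x(2) BU y Us_subset[OF j] by (intro marginal_antimono) auto
      also have "\<dots> \<le> ?w a"
      proof (cases "a = x")
        case True
        then have "i = j" using i(1) j a x(1) disjoint_Us unfolding disjoint_family_on_def by blast
        then show ?thesis using True x(4) y by simp
      next
        case False
        then show ?thesis using w(3)[OF j _ _ y] a x(2) by auto
      qed
      finally show ?thesis .
    qed
    ultimately show ?thesis using BU by blast
  qed
qed

text \<open>Within each block, an injection \<open>h\<close> charges the marginal value of every
  element of \<open>X\<close> to the recorded gain of a different element of \<open>A\<close>.
  Summed over the blocks, the marginals of \<open>X\<close> at \<open>A\<close> cost at most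
  \<open>f A - f {}\<close>.\<close>

lemma half_bound:
  assumes "({}, A) \<in> (\<Union>j\<in>{1..N}. pick_max f (Us j))\<^sup>*" "X \<subseteq> U"
    and "\<And>j. j \<in> {1..N} \<Longrightarrow> card (X \<inter> Us j) \<le> card (A \<inter> Us j)"
  shows "f X + f {} \<le> 2 * f A"
proof -
  obtain w where AU: "A \<subseteq> U" and w: "f A = f {} + (\<Sum>a\<in>A. w a)"
    "\<And>j a y. j \<in> {1..N} \<Longrightarrow> a \<in> A \<Longrightarrow> a \<in> Us j \<Longrightarrow> y \<in> Us j \<Longrightarrow> marginal f A y \<le> w a"
    using gains_dominate_marginals[OF assms(1) refl] by blast
  have fin: "finite (T \<inter> Us j)" if "T \<subseteq> U" for T j
    using that finite_U finite_subset by blast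
  have "(\<Sum>x\<in>X \<inter> Us j. marginal f A x) \<le> (\<Sum>a\<in>A \<inter> Us j. w a)" if j: "j \<in> {1..N}" for j
  proof -
    obtain h where h: "h ` (X \<inter> Us j) \<subseteq> A \<inter> Us j" "inj_on h (X \<inter> Us j)"
      using card_le_inj[OF fin[OF assms(2)] fin[OF AU] assms(3)[OF j]] by blast
    have "(\<Sum>x\<in>X \<inter> Us j. marginal f A x) \<le> (\<Sum>x\<in>X \<inter> Us j. w (h x))"
      using h(1) by (intro sum_mono w(2)[OF j]) auto
    also have "\<dots> = (\<Sum>a\<in>h ` (X \<inter> Us j). w a)" using h(2) by (simp add: sum.reindex)
    also have "\<dots> \<le> (\<Sum>a\<in>A \<inter> Us j. w a)"
    proof (rule sum_mono2[OF fin[OF AU] h(1)])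
      fix a assume a: "a \<in> A \<inter> Us j - h ` (X \<inter> Us j)"
      \<comment> \<open>Domination applied to \<open>a\<close> itself, whose marginal value at
        \<open>A\<close> is 0, shows that the uncharged gains are nonnegative.\<close>
      then show "0 \<le> w a" using w(2)[OF j, of a a] marginal_mem[of a A] by simp
    qed
    finally show ?thesis .
  qed
  then have "(\<Sum>j\<in>{1..N}. \<Sum>x\<in>X \<inter> Us j. marginal f A x) \<le> (\<Sum>j\<in>{1..N}. \<Sum>a\<in>A \<inter> Us j. w a)"
    by (rule sum_mono)
  then have "(\<Sum>x\<in>X. marginal f A x) \<le> f A - f {}"
    using w(1) sum_partition[OF assms(2), of "marginal f A"] sum_partition[OF AU, of w] by simp
  moreover have "f X \<le> f (A \<union> X)" using AU assms(2) by (intro f_mono) auto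
  ultimately show ?thesis using union_le_sum_marginal[OF AU assms(2)] by simp
qed

text \<open>The last conjunct allows this run to be appended to that of Block-Greedy, giving one
  sequence of block picks that starts at the empty set.\<close>

lemma greedy_run:
  assumes "(S, A) \<in> (greedy_step f U P)\<^sup>*" "P = partition_feasible U Us k N" "S \<in> P"
  shows "S \<subseteq> A \<and> A \<in> P \<and> (S, A) \<in> (\<Union>j\<in>{1..N}. pick_max f (Us j))\<^sup>*"
  using assms(1)
proof (induction rule: rtrancl_induct)
  case base
  then show ?case using assms(3) by simp
next
  case (step A B)
  then have "A \<subseteq> U" using assms(2) by (auto simp: partition_feasible_def)
  moreover have "A \<subseteq> B" using step(2) by (auto simp: greedy_step_def)
  ultimately show ?case
    using step greedy_step_pick_max[OF step(2) assms(2)] by (blast intro: rtrancl_into_rtrancl)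
qed

text \<open>An element missing from a block that is not full could be added, since by disjointness
  it raises no other count. Full blocks are what provides the injection from the optimum into
  \<open>A\<close>.\<close>

lemma maximal_feasible_card:
  assumes "A \<in> P" "P = partition_feasible U Us k N" "\<not> (\<exists>x\<in>U - A. A \<union> {x} \<in> P)"
    and "j \<in> {1..N}" "k j \<le> card (Us j)"
  shows "k j \<le> card (A \<inter> Us j)"
proof (rule ccontr)
  assume less: "\<not> k j \<le> card (A \<inter> Us j)"
  then have "card (A \<inter> Us j) < card (Us j)" using assms(5) by simp
  then obtain x where x: "x \<in> Us j" "x \<notin> A" by (metis Int_absorb1 less_irrefl subsetI)
  have xU: "x \<in> U" using x Us_subset[OF assms(4)] by blast
  have A: "A \<subseteq> U" "\<And>i. i \<in> {1..N} \<Longrightarrow> card (A \<inter> Us i) \<le> k i"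
    using assms(1,2) by (auto simp: partition_feasible_def)
  have "finite A" using A finite_U finite_subset by blast
  have "card ((A \<union> {x}) \<inter> Us i) \<le> k i" if i: "i \<in> {1..N}" for i
  proof (cases "i = j")
    case True
    then show ?thesis using x less \<open>finite A\<close> by (simp add: Int_insert_left)
  next
    case False
    then have "x \<notin> Us i" using disjoint_Us i assms(4) x unfolding disjoint_family_on_def by blast
    then show ?thesis using A(2)[OF i] by simp
  qed
  then have "A \<union> {x} \<in> P" using A xU unfolding assms(2) partition_feasible_def by auto
  then show False using assms(3) x xU by blast
qed

end

lemma for_loop_subset_rtrancl:
  assumes "\<And>i. i \<in> {1..n} \<Longrightarrow> R i \<subseteq> Q\<^sup>*"
  shows "for_loop R n \<subseteq> Q\<^sup>*"
  using assms
proof (induction n)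
  case (Suc n)
  have "for_loop R n \<subseteq> Q\<^sup>*" using Suc by simp
  moreover have "R (Suc n) \<subseteq> Q\<^sup>*" using Suc.prems by simp
  ultimately show ?case by (auto intro: rtrancl_trans)
qed auto

text \<open>The factor 1/2 needs neither the order of the blocks nor the numbers of picks, so the
  loops are flattened into arbitrary block picks.\<close>

lemma block_greedy_mono_rtrancl:
  assumes "S \<in> block_greedy_mono f Us N r m"
  shows "({}, S) \<in> (\<Union>j\<in>{1..N}. pick_max f (Us j))\<^sup>*"
proof -
  let ?Q = "\<Union>j\<in>{1..N}. pick_max f (Us j)"
  have "for_loop (\<lambda>i. for_loop (\<lambda>j. greedy_subroutine_mono f (Us j) (r j)) N) m \<subseteq> ?Q\<^sup>*"
  proof (intro for_loop_subset_rtrancl)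
    fix j assume j: "j \<in> {1..N}"
    have "pick_max f (Us j) ^^ r j \<subseteq> (pick_max f (Us j))\<^sup>*" by (auto intro: relpow_imp_rtrancl)
    also have "\<dots> \<subseteq> ?Q\<^sup>*" using j by (intro rtrancl_mono) blast
    finally show "greedy_subroutine_mono f (Us j) (r j) \<subseteq> ?Q\<^sup>*" by (simp add: greedy_subroutine_mono_def)
  qed
  then show ?thesis using assms unfolding block_greedy_mono_def by blast
qed

section \<open>Numerical estimates for the number of rounds and the block quotas\<close>

text \<open>This is the fraction of the gap left after \<open>m\<close> rounds with
  \<open>c = 1 / (m + 1)\<close>. It is at most \<open>exp (- 1)\<close> times the correction
  \<open>exp (2 / (m + 2))\<close>, which adds at most \<open>1 / (m + 1)\<close>.\<close>

lemma inverse_power_le_inverse_exp: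
  fixes m :: nat
  assumes "1 \<le> m"
  shows "1 / (1 + 1 / (real m + 1)) ^ m \<le> 1 / exp 1 + 1 / (real m + 1)"
proof -
  define x :: real where "x = 1 / (real m + 2)"
  have base: "1 / (1 + 1 / (real m + 1)) = 1 - x" by (simp add: x_def field_simps)
  have pos: "0 < 1 - x" by (simp add: x_def)
  have le: "1 - x \<le> exp (- x)" using exp_ge_add_one_self[of "- x"] by simp
  have "1 / (1 + 1 / (real m + 1)) ^ m = (1 - x) ^ m" using base by (metis power_one_over)
  also have "\<dots> \<le> exp (- x) ^ m" using le pos by (intro power_mono) auto
  \<comment> \<open>Writing \<open>m\<close> as \<open>(m + 2) - 2\<close> turns the exponent
    \<open>- m * x\<close> into \<open>- 1 + 2 * x\<close>.\<close>
  also have "\<dots> = exp (- 1) * exp x ^ 2"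
  proof -
    have "real m * (- x) = - 1 + real 2 * x" by (simp add: x_def field_simps)
    then show ?thesis by (simp flip: exp_of_nat_mult exp_add)
  qed
  also have "\<dots> \<le> exp (- 1) * (1 + exp 1 / (real m + 1))"
  proof (intro mult_left_mono)
    have "exp x \<le> 1 / (1 - x)" using le pos by (simp add: exp_minus field_simps)
    also have "\<dots> = 1 + 1 / (real m + 1)" by (simp add: x_def field_simps)
    finally have "exp x ^ 2 \<le> (1 + 1 / (real m + 1)) ^ 2" by (intro power_mono) auto
    also have "\<dots> = 1 + (2 + 1 / (real m + 1)) / (real m + 1)"
      by (simp add: power2_eq_square add_divide_distrib algebra_simps)
    also have "\<dots> \<le> 1 + exp 1 / (real m + 1)"
    proof -
      \<comment> \<open>As \<open>m\<close> is at least 1, the numerator is at most 5/2 = 1 + 1 +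
        1/2, the quadratic Taylor bound below \<open>exp 1\<close>.\<close>
      have "1 / (real m + 1) \<le> 1 / 2" using assms by (simp add: field_simps)
      then have "2 + 1 / (real m + 1) \<le> exp 1"
        using exp_lower_Taylor_quadratic[OF zero_le_one] unfolding one_power2 by linarith
      then show ?thesis by (intro add_left_mono divide_right_mono) auto
    qed
    finally show "exp x ^ 2 \<le> 1 + exp 1 / (real m + 1)" .
  qed simp
  also have "\<dots> = 1 / exp 1 + 1 / (real m + 1)" by (simp add: exp_minus field_simps)
  finally show ?thesis .
qed

text \<open>Rounding down loses at most \<open>m\<close> from \<open>k\<close>; one additional
  summand \<open>k div m\<close> repays this, being at least \<open>m\<close> because
  \<open>m * m\<close> is at most \<open>k\<close>.\<close>

lemma le_Suc_mult_div:
  fixes k m :: nat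
  assumes "0 < m" "(m + 1)\<^sup>2 \<le> k"
  shows "k \<le> (m + 1) * (k div m)"
proof -
  have "m * m \<le> k" using assms(2) by (simp add: power2_eq_square)
  then have "m \<le> k div m" using assms(1) by (simp add: less_eq_div_iff_mult_less_eq)
  moreover have "k \<le> m * (k div m) + m"
    using mult_div_mod_eq[of m k] mod_less_divisor[OF assms(1), of k] by linarith
  ultimately show ?thesis by simp
qed

section \<open>Combination of the two approximation factors\<close>

theorem theorem10:
  fixes f :: "'a set \<Rightarrow> real" and U :: "'a set" and Us :: "nat \<Rightarrow> 'a set"
    and N \<phi> :: nat and k r :: "nat \<Rightarrow> nat" and P :: "'a set set" and S A OPT :: "'a set"
  assumes "finite U"
    and "\<And>X. X \<subseteq> U \<Longrightarrow> 0 \<le> f X"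
    and "mono_on (Pow U) f"
    and "submodular_on U f"
    and "1 \<le> N"
    and "(\<Union>j\<in>{1..N}. Us j) = U"
    and "disjoint_family_on Us {1..N}"
    and "\<And>j. j \<in> {1..N} \<Longrightarrow> 0 < k j \<and> k j \<le> card (Us j)"
    and "4 \<le> Min (k ` {1..N})"
    and "P = partition_feasible U Us k N"
    and "\<phi> = nat (\<lfloor>sqrt (real (Min (k ` {1..N})))\<rfloor> - 1)"
    and "\<And>j. j \<in> {1..N} \<Longrightarrow> r j = nat \<lfloor>real (k j) / real \<phi>\<rfloor>"
    and "S \<in> block_greedy_mono f Us N r \<phi>"
    and "A \<in> greedy f U P S"
    and "is_arg_max f (\<lambda>X. X \<in> P) OPT"
  shows "f A \<ge> max (1 / 2) (1 - 1 / exp 1 - 1 / (real \<phi> + 1)) * f OPT"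
proof -
  interpret partitioned_submodular f U Us N
    using assms(1,3,4,6,7) by unfold_locales
  define K where "K = Min (k ` {1..N})"
  have K: "4 \<le> K" "\<And>j. j \<in> {1..N} \<Longrightarrow> K \<le> k j" using assms(9) by (auto simp: K_def)
  \<comment> \<open>A minimum quota of 4 makes the floor of the square root at least 2, so
    \<open>nat\<close> truncates nothing and \<phi> is positive.\<close>
  have "2 \<le> sqrt (real K)" using K(1) by (intro real_le_rsqrt) simp
  then have s: "2 \<le> \<lfloor>sqrt (real K)\<rfloor>" by (simp add: le_floor_iff)
  then have \<phi>: "1 \<le> \<phi>" "real \<phi> + 1 \<le> sqrt (real K)"
    using assms(11) unfolding K_def[symmetric] by linarith+
  from \<phi>(2) have "(real \<phi> + 1)\<^sup>2 \<le> (sqrt (real K))\<^sup>2" by (rule power_mono) simp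
  then have "real ((\<phi> + 1)\<^sup>2) \<le> real K" by (simp add: add.commute)
  then have \<phi>K: "(\<phi> + 1)\<^sup>2 \<le> K" by linarith
  have r: "r j = k j div \<phi>" if "j \<in> {1..N}" for j
    using assms(12)[OF that] by (simp add: floor_divide_of_nat_eq)
  define c where "c = 1 / (real \<phi> + 1)"
  have OPT_U: "OPT \<subseteq> U"
    and OPT_card: "\<And>j. j \<in> {1..N} \<Longrightarrow> card (OPT \<inter> Us j) \<le> k j"
    using assms(10,15) by (auto simp: is_arg_max_def partition_feasible_def)
  have c: "c * real (card (OPT \<inter> Us j)) \<le> real (r j)" if j: "j \<in> {1..N}" for j
  proof -
    have "card (OPT \<inter> Us j) \<le> (\<phi> + 1) * r j"
      using OPT_card[OF j] r[OF j] le_Suc_mult_div[of \<phi> "k j"] \<phi>(1) \<phi>K K(2)[OF j] by simp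
    then have "real (card (OPT \<inter> Us j)) \<le> real ((\<phi> + 1) * r j)" by (rule of_nat_mono)
    then show ?thesis by (simp add: c_def field_simps)
  qed
  have S: "S \<subseteq> U" "\<And>j. j \<in> {1..N} \<Longrightarrow> card (S \<inter> Us j) \<le> \<phi> * r j"
      "(1 + c) ^ \<phi> * (f OPT - f S) \<le> f OPT - f {}"
    using rounds_gap[OF _ _ OPT_U _ c, of "{}" S \<phi>] assms(13)
    by (auto simp: block_greedy_mono_def c_def)
  \<comment> \<open>Here \<phi> rounds of \<open>k j div \<phi>\<close> picks stay within the quota
    \<open>k j\<close>, so Greedy starts from a feasible set.\<close>
  have "card (S \<inter> Us j) \<le> k j" if "j \<in> {1..N}" for j
    using S(2)[OF that] r[OF that] by (simp add: order.trans)
  then have "S \<in> P" using S(1) unfolding assms(10) partition_feasible_def by blast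
  then have A: "S \<subseteq> A" "A \<in> P" "(S, A) \<in> (\<Union>j\<in>{1..N}. pick_max f (Us j))\<^sup>*"
    and max_A: "\<not> (\<exists>x\<in>U - A. A \<union> {x} \<in> P)"
    using greedy_run[OF _ assms(10)] assms(14) by (auto simp: greedy_def)
  have f0: "0 \<le> f {}" using assms(2) by simp
  have half: "1 / 2 * f OPT \<le> f A"
  proof -
    have "f OPT + f {} \<le> 2 * f A"
    proof (rule half_bound[OF _ OPT_U])
      show "({}, A) \<in> (\<Union>j\<in>{1..N}. pick_max f (Us j))\<^sup>*"
        using block_greedy_mono_rtrancl[OF assms(13)] A(3) by (rule rtrancl_trans)
      show "card (OPT \<inter> Us j) \<le> card (A \<inter> Us j)" if j: "j \<in> {1..N}" for j
        using OPT_card[OF j] maximal_feasible_card[OF A(2) assms(10) max_A j] assms(8)[OF j] by simp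
    qed
    then show ?thesis using f0 by simp
  qed
  have main: "(1 - 1 / exp 1 - 1 / (real \<phi> + 1)) * f OPT \<le> f A"
  proof -
    have pos: "0 < (1 + c) ^ \<phi>" by (simp add: c_def add_pos_pos)
    have "(1 + c) ^ \<phi> * (f OPT - f S) \<le> f OPT" using S(3) f0 by simp
    then have "f OPT - f S \<le> 1 / (1 + c) ^ \<phi> * f OPT"
      using pos by (simp add: pos_le_divide_eq mult.commute)
    \<comment> \<open>The numerical bound may be multiplied by \<open>f OPT\<close> because
      \<open>f\<close> is nonnegative.\<close>
    also have "\<dots> \<le> (1 / exp 1 + 1 / (real \<phi> + 1)) * f OPT"
      using inverse_power_le_inverse_exp[OF \<phi>(1)] assms(2)[OF OPT_U] unfolding c_def
      by (intro mult_right_mono)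
    finally have "(1 - 1 / exp 1 - 1 / (real \<phi> + 1)) * f OPT \<le> f S" by (simp add: algebra_simps)
    also have "f S \<le> f A" using A(1,2) assms(10) by (intro f_mono) (auto simp: partition_feasible_def)
    finally show ?thesis .
  qed
  show ?thesis using half main unfolding max_def by presburger
qed

end
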